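(* Let $n$ be one of the integers for which $\mathbb{Z}[\xi_n]$ has class number one, $\mathcal{M}_n=\mathbb{Z}[\xi_n]$, and $I$ a principal ideal of $\mathcal{M}_n$ of index $\ell$. With respect to the basis $\{1,\xi_n,\dots,\xi_n^{\varphi(n)-1}\}$, let $S$ be the $\varphi(n)\times\varphi(n)$ matrix whose columns generate the sublattice $L$ representing $I$, let $A$ and $B$ be the matrices representing $\phi_1$ and $\phi_2$ respectively, and let $x_1+L,\dots,x_\ell+L$ be the cosets of $L$ in $\Lambda$ (with $x_i$ integer coordinate vectors). For the Bravais coloring of $\mathcal{M}_n$ determined by $I$, with color symmetry group $H$ and color fixing group $K$: (i) $\phi_2\in K$ if and only if $\phi_2\in H$ and $S^{-1}(Bx_i-x_i)$ is an integral vector for all $i=1,\dots,\ell$; (ii) for $k$ dividing $N$, $\phi_1^k\in K$ if and only if $S^{-1}(A^kx_i-x_i)$ is an integral vector for all $i=1,\dots,\ell$.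
   Context: Standing assumption: $n\in\{3,4,5,7,8,9,11,12,13,15,16,17,19,20,21,24,25,27,28,32,33,35,36,40,44,45,48,60,84\}$ (the values for which $\mathcal{M}_n=\mathbb{Z}[\xi_n]$, $\xi_n=\exp(2\pi i/n)$, is a principal ideal domain). Let $\varphi$ be Euler's function and $N=n$ if $n$ is even, $N=2n$ if $n$ is odd. Using the $\mathbb{Z}$-basis $\{1,\xi_n,\dots,\xi_n^{\varphi(n)-1}\}$ of $\mathcal{M}_n$, each element is identified with its integer coordinate vector, so $\mathcal{M}_n$ becomes a lattice $\Lambda=\mathbb{Z}^{\varphi(n)}\subset\mathbb{R}^{\varphi(n)}$, and a principal ideal $I$ of index $\ell$ becomes a sublattice $L\subseteq\Lambda$ of index $\ell$. Let $\phi_1$ be the linear map induced by multiplication by $\exp(2\pi i/N)$ (an $N$-fold rotation) and $\phi_2$ the linear map induced by complex conjugation (a reflection); they generate a dihedral group $D_N$ of order $2N$. Let $T(G)=\{t_y: x\mapsto x+y \mid y\in\Lambda\}$; the symmetry group of $\Lambda$ is $G=T(G)\rtimes D_N$. The Bravais coloring determined by $I$ assigns to each element of $\Lambda$ one of $\ell$ colors, two elements getting the same color iff they lie in the same coset of $L$ in $\Lambda$. The color symmetry group $H$ is the set of $g\in G$ such that for every coset $x+L$ the image $g(x+L)$ is again a coset of $L$; the color fixing group $K$ is the set of $g\in H$ with $g(x+L)=x+L$ for all $x\in\Lambda$. *)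

theory Defs
  imports "Jordan_Normal_Form.Matrix" "HOL-Number_Theory.Number_Theory"
begin

definition pid_cyclotomic_indices :: "nat set" where
  "pid_cyclotomic_indices = {3,4,5,7,8,9,11,12,13,15,16,17,19,20,21,24,25,27,28,32,33,35,36,40,44,45,48,60,84}"

definition xi :: "nat \<Rightarrow> complex" where
  "xi n = cis (2 * pi / real n)"

definition bigN :: "nat \<Rightarrow> nat" where
  "bigN n = (if even n then n else 2 * n)"

definition Lambda :: "nat \<Rightarrow> int vec set" where
  "Lambda n = carrier_vec (totient n)"

definition emb :: "nat \<Rightarrow> int vec \<Rightarrow> complex" where
  "emb n v = (\<Sum>j<totient n. of_int (v $ j) * xi n ^ j)"

definition Mring :: "nat \<Rightarrow> complex set" where
  "Mring n = emb n ` Lambda n"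

definition coords :: "nat \<Rightarrow> complex \<Rightarrow> int vec" where
  "coords n z = (THE v. v \<in> Lambda n \<and> emb n v = z)"

definition phi1 :: "nat \<Rightarrow> int vec \<Rightarrow> int vec" where
  "phi1 n v = coords n (cis (2 * pi / real (bigN n)) * emb n v)"

definition phi2 :: "nat \<Rightarrow> int vec \<Rightarrow> int vec" where
  "phi2 n v = coords n (cnj (emb n v))"

definition dihedral :: "nat \<Rightarrow> (int vec \<Rightarrow> int vec) set" where
  "dihedral n = {(phi1 n ^^ k) \<circ> (phi2 n ^^ j) | k j. True}"

definition symG :: "nat \<Rightarrow> (int vec \<Rightarrow> int vec) set" where
  "symG n = {(\<lambda>v. r v + y) | r y. r \<in> dihedral n \<and> y \<in> Lambda n}"

definition principal_ideal :: "nat \<Rightarrow> complex \<Rightarrow> complex set" where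
  "principal_ideal n a = {a * b | b. b \<in> Mring n}"

definition lcoset :: "int vec set \<Rightarrow> int vec \<Rightarrow> int vec set" where
  "lcoset L x = (\<lambda>y. x + y) ` L"

definition lcosets :: "nat \<Rightarrow> int vec set \<Rightarrow> int vec set set" where
  "lcosets n L = {lcoset L x | x. x \<in> Lambda n}"

definition color_symmetry :: "nat \<Rightarrow> int vec set \<Rightarrow> (int vec \<Rightarrow> int vec) set" where
  "color_symmetry n L = {g \<in> symG n. \<forall>x \<in> Lambda n. \<exists>x' \<in> Lambda n. g ` lcoset L x = lcoset L x'}"

definition color_fixing :: "nat \<Rightarrow> int vec set \<Rightarrow> (int vec \<Rightarrow> int vec) set" where
  "color_fixing n L = {g \<in> color_symmetry n L. \<forall>x \<in> Lambda n. g ` lcoset L x = lcoset L x}"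

definition integral_vec :: "real vec \<Rightarrow> bool" where
  "integral_vec v = (\<forall>j < dim_vec v. v $ j \<in> \<int>)"

end

theory Submission
  imports Defs "Jordan_Normal_Form.Char_Poly"
begin

text \<open>
  A color symmetry that sends each coset representative \<open>x\<^sub>i\<close> into its own coset fixes every
  coset, because it permutes the cosets; and \<open>v \<in> L\<close> means that \<open>S\<^sup>-\<^sup>1 v\<close> is integral. The condition
  \<open>\<phi>\<^sub>1\<^sup>k \<in> H\<close> is automatic: multiplication by a unit of \<open>\<int>[\<xi>]\<close> maps the ideal onto itself.

  This presupposes that the \<open>\<xi>\<^sup>j\<close> with \<open>j < \<phi>(n)\<close> really form an integral basis, that is,
  that the minimal polynomial \<open>f\<close> of \<open>\<xi>\<close> has degree \<open>\<phi>(n)\<close>. The argument is Landau's: the value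
  \<open>f(\<xi>\<^sup>k)\<close> is a reduced integer polynomial in \<open>\<xi>\<close> which depends only on \<open>k mod n\<close>, so its coefficients
  are bounded by some \<open>M\<close>. Since \<open>f(X\<^sup>p) \<equiv> f(X)\<^sup>p\<close> modulo a prime \<open>p\<close>, for \<open>k = p\<close> they are divisible
  by \<open>p\<close>, and hence vanish if \<open>p > M\<close>. Every \<open>r\<close> coprime to \<open>n\<close> is congruent modulo \<open>n\<close> to a product of
  primes greater than \<open>M\<close>, so all \<open>\<xi>\<^sup>r\<close> are roots of \<open>f\<close>.
\<close>

section \<open>Minimal polynomials of algebraic integers\<close>

text \<open>Minimality ranges over all nonzero integer polynomials, monic or not: division
  remainders need not be monic, and this is what forces them to vanish.\<close>

definition int_minpoly :: "int poly \<Rightarrow> complex \<Rightarrow> bool" where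
  "int_minpoly f z \<longleftrightarrow> lead_coeff f = 1 \<and> poly (of_int_poly f) z = 0 \<and>
     (\<forall>g. g \<noteq> 0 \<longrightarrow> poly (of_int_poly g) z = 0 \<longrightarrow> degree f \<le> degree g)"

text \<open>Pseudo-division scales the dividend by a power of the divisor's leading coefficient,
  here 1, so it is genuine division over the integers.\<close>

lemma monic_division:
  fixes f g :: "int poly"
  assumes "lead_coeff f = 1"
  obtains q r where "g = f * q + r" "r = 0 \<or> degree r < degree f"
proof -
  obtain q r where qr: "pseudo_divmod g f = (q, r)" by force
  have "f \<noteq> 0" using assms by auto
  from pseudo_divmod[OF this qr] assms have "g = f * q + r" "r = 0 \<or> degree r < degree f" by auto
  then show thesis by (rule that)
qed

lemma int_minpoly_remainder:
  assumes "int_minpoly f z"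
  obtains r where "poly (of_int_poly r) z = poly (of_int_poly g) z" "r = 0 \<or> degree r < degree f"
proof -
  from assms have "lead_coeff f = 1" by (simp add: int_minpoly_def)
  then obtain q r where "g = f * q + r" "r = 0 \<or> degree r < degree f" by (rule monic_division)
  with assms show thesis by (intro that[of r]) (auto simp: int_minpoly_def hom_distribs)
qed

lemma int_minpoly_eq_0:
  assumes "int_minpoly f z" "poly (of_int_poly r) z = 0" "r = 0 \<or> degree r < degree f"
  shows "r = 0"
  using assms by (force simp: int_minpoly_def)

lemma int_minpoly_dvd:
  assumes "int_minpoly f z" "poly (of_int_poly g) z = 0"
  shows "f dvd g"
proof -
  from assms have "lead_coeff f = 1" by (simp add: int_minpoly_def)
  then obtain q r where qr: "g = f * q + r" "r = 0 \<or> degree r < degree f" by (rule monic_division)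
  with assms have "poly (of_int_poly r) z = 0" by (auto simp: int_minpoly_def hom_distribs)
  with assms(1) qr have "r = 0" by (intro int_minpoly_eq_0)
  with qr show ?thesis by simp
qed

text \<open>A primitive integer polynomial of least degree vanishing at \<open>z\<close> divides a
  multiple of \<open>h\<close>. By Gauss it then divides \<open>h\<close> up to sign, so its leading
  coefficient is 1 or -1.\<close>

lemma int_minpoly_exists:
  assumes "lead_coeff h = 1" "poly (of_int_poly h) z = 0"
  obtains f where "int_minpoly f z"
proof -
  let ?P = "\<lambda>g::int poly. g \<noteq> 0 \<and> poly (of_int_poly g) z = 0"
  have "?P h" using assms by auto
  then obtain g where g: "?P g" "\<And>g'. ?P g' \<Longrightarrow> degree g \<le> degree g'"
    using exists_least_iff[of "\<lambda>d. \<exists>g. ?P g \<and> degree g = d"] by (metis not_less)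
  define g1 where "g1 = primitive_part g"
  have gg1: "g = smult (content g) g1" by (simp add: g1_def)
  have cg: "content g \<noteq> 0" using g by simp
  have "poly (of_int_poly g) z = of_int (content g) * poly (of_int_poly g1) z"
    by (subst gg1) (simp add: hom_distribs)
  then have g1: "poly (of_int_poly g1) z = 0" using g cg by simp
  have g1_0: "g1 \<noteq> 0" using g by (simp add: g1_def)
  have dg1: "degree g1 = degree g" by (simp add: g1_def)
  obtain c q where cq: "c \<noteq> 0" "smult c h = g1 * q + pseudo_mod h g1"
    using pseudo_mod(1)[OF g1_0, of h] by blast
  have r: "pseudo_mod h g1 = 0 \<or> degree (pseudo_mod h g1) < degree g1"
    using pseudo_mod(2)[OF g1_0] .
  have "poly (of_int_poly (smult c h)) z = poly (of_int_poly (g1 * q + pseudo_mod h g1)) z"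
    by (simp add: cq)
  then have "poly (of_int_poly (pseudo_mod h g1)) z = 0"
    using assms g1 by (simp add: hom_distribs)
  then have "pseudo_mod h g1 = 0" using g(2)[of "pseudo_mod h g1"] r dg1 by force
  then have e: "smult c h = g1 * q" using cq by simp
  have "content h dvd 1"
    using content_dvd_coeff[of h "degree h"] assms by simp
  then have ch: "content h = 1" by (metis is_unit_normalize normalize_content)
  \<comment> \<open>Gauss: taking primitive parts turns the pseudo-division into a factorization of \<open>h\<close>.\<close>
  have "smult (unit_factor c) h = g1 * primitive_part q"
    using arg_cong[OF e, of primitive_part] ch
    by (simp add: primitive_part_smult primitive_part_mult primitive_part_prim g1_def g)
  then have "lead_coeff (smult (unit_factor c) h) = lead_coeff g1 * lead_coeff (primitive_part q)"
    by (simp add: lead_coeff_mult)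
  then have "unit_factor c = lead_coeff g1 * lead_coeff (primitive_part q)"
    using assms cq(1) by (simp add: sgn_eq_0_iff)
  then have "lead_coeff g1 dvd unit_factor c" by (metis dvd_triv_left)
  then have u: "lead_coeff g1 dvd 1" using cq(1) unit_factor_is_unit dvd_trans by blast
  then have u2: "lead_coeff g1 * lead_coeff g1 = 1" by (auto simp: zdvd1_eq abs_if split: if_splits)
  \<comment> \<open>The leading coefficient is its own inverse, so scaling by it makes
    \<open>g1\<close> monic.\<close>
  define f where "f = smult (lead_coeff g1) g1"
  have "lead_coeff f = 1" using u2 g1_0 by (simp add: f_def)
  moreover have "poly (of_int_poly f) z = 0" using g1 by (simp add: f_def hom_distribs)
  moreover have "degree f = degree g" using dg1 u2 by (auto simp: f_def)
  ultimately have "int_minpoly f z" using g(2) by (auto simp: int_minpoly_def)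
  then show thesis by (rule that)
qed

lemma monic_dvd_antisym:
  fixes f g :: "int poly"
  assumes "f dvd g" "g dvd f" "lead_coeff f = 1" "lead_coeff g = 1"
  shows "f = g"
proof -
  obtain h where h: "g = f * h" using assms by auto
  have nz: "f \<noteq> 0" "g \<noteq> 0" using assms by auto
  have "degree f = degree g" using assms nz by (simp add: dvd_imp_degree_le antisym)
  with h nz have "degree h = 0" by (auto simp: degree_mult_eq)
  moreover have "lead_coeff h = 1" using assms h by (simp add: lead_coeff_mult)
  ultimately have "h = 1" by (metis degree_0_id one_pCons)
  with h show ?thesis by simp
qed

text \<open>The minimal polynomial \<open>g\<close> of \<open>w\<close> divides \<open>f\<close>, so
  \<open>z\<close> is a root of \<open>g\<close> or of the cofactor. In the first case
  \<open>f\<close> divides \<open>g\<close>, so the two agree; in the second \<open>g\<close> would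
  be the constant 1, which has no root.\<close>

lemma int_minpoly_conjugate:
  assumes f: "int_minpoly f z" and w: "poly (of_int_poly f) w = 0"
  shows "int_minpoly f w"
proof -
  have lf: "lead_coeff f = 1" "poly (of_int_poly f) z = 0" using f by (auto simp: int_minpoly_def)
  obtain g where g: "int_minpoly g w" using int_minpoly_exists[OF lf(1) w] .
  have lg: "lead_coeff g = 1" "poly (of_int_poly g) w = 0" using g by (auto simp: int_minpoly_def)
  from int_minpoly_dvd[OF g w] obtain h where h: "f = g * h" by auto
  have "poly (of_int_poly g) z = 0 \<or> poly (of_int_poly h) z = 0"
    using lf(2) by (simp add: h hom_distribs)
  then show ?thesis
  proof
    assume "poly (of_int_poly g) z = 0"
    then have "f dvd g" by (rule int_minpoly_dvd[OF f])
    then have "f = g" using h lf lg by (intro monic_dvd_antisym) auto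
    with g show ?thesis by simp
  next
    assume "poly (of_int_poly h) z = 0"
    then have "f dvd h" by (rule int_minpoly_dvd[OF f])
    moreover have "h \<noteq> 0" "g \<noteq> 0" using h lf by auto
    ultimately have "degree f \<le> degree h" by (simp add: dvd_imp_degree_le)
    then have "degree g = 0" using h \<open>h \<noteq> 0\<close> \<open>g \<noteq> 0\<close> by (simp add: degree_mult_eq)
    then have "g = 1" using lg(1) by (metis degree_0_id one_pCons)
    with lg(2) show ?thesis by simp
  qed
qed

section \<open>Irreducibility of cyclotomic polynomials\<close>

text \<open>All inner binomial coefficients are divisible by \<open>p\<close>. The ring is kept
  general because both integers and integer polynomials are substituted later.\<close>

lemma freshmans_dream_dvd:
  fixes x y :: "'a :: comm_ring_1"
  assumes p: "prime p"
  shows "of_nat p dvd (x + y) ^ p - (x ^ p + y ^ p)"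
proof -
  have p0: "p > 0" using p prime_gt_0_nat by blast
  let ?t = "\<lambda>k. of_nat (p choose k) * x ^ k * y ^ (p - k)"
  have "(x + y) ^ p = (\<Sum>k\<le>p. ?t k)" by (rule binomial_ring)
  also have "{..p} = insert 0 (insert p {1..<p})" using p0 by auto
  also have "sum ?t \<dots> = x ^ p + y ^ p + sum ?t {1..<p}" using p0 by (simp add: add_ac)
  finally have "(x + y) ^ p - (x ^ p + y ^ p) = sum ?t {1..<p}" by simp
  moreover have "of_nat p dvd ?t k" if "k \<in> {1..<p}" for k
  proof -
    have "p dvd (p choose k)" using that p by (intro dvd_choose_prime) auto
    then have "(of_nat p :: 'a) dvd of_nat (p choose k)" by auto
    then show ?thesis by (simp add: mult.assoc)
  qed
  ultimately show ?thesis using dvd_sum[of "{1..<p}" "of_nat p" ?t] by simp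
qed

lemma prime_dvd_power_diff_self:
  fixes a :: int
  assumes p: "prime p"
  shows "int p dvd a ^ p - a"
proof -
  have nn: "int p dvd int m ^ p - int m" for m
  proof (induction m)
    case 0
    then show ?case using prime_gt_0_nat[OF p] by (simp add: zero_power)
  next
    case (Suc m)
    have "int p dvd ((int m + 1) ^ p - (int m ^ p + 1 ^ p)) + (int m ^ p - int m)"
      using freshmans_dream_dvd[OF p, of "int m" 1] Suc by (intro dvd_add) auto
    then show ?case by (simp add: algebra_simps)
  qed
  \<comment> \<open>Induction covers only nonnegative integers. A negative \<open>a\<close> is
    shifted by its absolute value, and the shift is removed again by the freshman's dream.\<close>
  have pp: "int p dvd (a + int m) ^ p - (a ^ p + int m ^ p)" for m
    using freshmans_dream_dvd[OF p, of a "int m"] by simp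
  define m where "m = nat \<bar>a\<bar>"
  define b where "b = nat (a + int m)"
  have b: "a + int m = int b" by (auto simp: b_def m_def)
  have "int p dvd (int b ^ p - int b) - (int b ^ p - (a ^ p + int m ^ p)) - (int m ^ p - int m)"
    using dvd_diff[OF dvd_diff[OF nn[of b] pp[of m, unfolded b]] nn[of m]] .
  also have "\<dots> = a ^ p - a" using b by simp
  finally show ?thesis .
qed

text \<open>Induction on the coefficients: the freshman's dream splits the power of
  \<open>[:a:] + [:0, 1:] * f\<close>, and Fermat's little theorem replaces \<open>a ^ p\<close> by
  \<open>a\<close>.\<close>

lemma pcompose_monom_cong_power:
  fixes f :: "int poly"
  assumes p: "prime p"
  shows "of_nat p dvd pcompose f (monom 1 p) - f ^ p"
proof (induction f)
  case 0
  then show ?case using prime_gt_0_nat[OF p] by (simp add: zero_power)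
next
  case (pCons a f)
  have m: "monom (1::int) p = [:0, 1:] ^ p" by (simp add: monom_altdef)
  have e: "pCons a f = [:a:] + [:0, 1:] * f" by simp
  have 1: "of_nat p dvd (pCons a f) ^ p - ([:a:] ^ p + [:0, 1:] ^ p * f ^ p)"
    using freshmans_dream_dvd[OF p, of "[:a:]" "[:0, 1:] * f"] unfolding e power_mult_distrib .
  have "[:int p:] dvd [:a ^ p - a:]" using prime_dvd_power_diff_self[OF p, of a] 
    by (simp add: const_poly_dvd)
  then have 2: "of_nat p dvd [:a:] ^ p - [:a:]" by (simp add: of_nat_poly poly_const_pow)
  have 3: "of_nat p dvd [:0, 1:] ^ p * (pcompose f (monom 1 p) - f ^ p)"
    using pCons.IH by (rule dvd_mult)
  have "of_nat p dvd [:0, 1:] ^ p * (pcompose f (monom 1 p) - f ^ p) - ([:a:] ^ p - [:a:])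
       - ((pCons a f) ^ p - ([:a:] ^ p + [:0, 1:] ^ p * f ^ p))"
    using dvd_diff[OF dvd_diff[OF 3 2] 1] .
  also have "\<dots> = pcompose (pCons a f) (monom 1 p) - (pCons a f) ^ p"
    by (simp add: pcompose_pCons m algebra_simps)
  finally show ?case .
qed

section \<open>Landau's argument: powers of a root of unity that are again roots\<close>

lemma poly_pcompose_monom:
  "poly (of_int_poly (pcompose f (monom 1 k))) (z::complex) = poly (of_int_poly f) (z ^ k)"
  by (simp add: hom_distribs poly_pcompose poly_monom)

text \<open>Vanishing at \<open>z ^ p\<close> means that \<open>f\<close> divides
  \<open>f(X^p)\<close>, and this divisibility can be evaluated at every root \<open>w\<close>. So
  the bound \<open>M\<close>, computed from \<open>z\<close> alone, stays valid when the step is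
  iterated.\<close>

lemma int_minpoly_large_prime:
  assumes f: "int_minpoly f z" and z: "z ^ n = 1" and n: "n > 0"
  obtains M where "\<And>p (w::complex). prime p \<Longrightarrow> p > M \<Longrightarrow> poly (of_int_poly f) w = 0 \<Longrightarrow>
    poly (of_int_poly f) (w ^ p) = 0"
proof -
  have "\<exists>r. poly (of_int_poly r) z = poly (of_int_poly f) (z ^ k) \<and> (r = 0 \<or> degree r < degree f)" for k
    using int_minpoly_remainder[OF f, of "pcompose f (monom 1 k)"]
    unfolding poly_pcompose_monom by metis
  then obtain r where r: "\<And>k. poly (of_int_poly (r k)) z = poly (of_int_poly f) (z ^ k)"
    "\<And>k. r k = 0 \<or> degree (r k) < degree f" by metis
  \<comment> \<open>Finitely many remainders suffice, since \<open>z ^ p\<close> depends only on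
    \<open>p mod n\<close>.\<close>
  define M where "M = (\<Sum>k<n. \<Sum>i\<le>degree (r k). nat \<bar>coeff (r k) i\<bar>)"
  have M: "nat \<bar>coeff (r k) i\<bar> \<le> M" if "k < n" for k i
  proof (cases "i \<le> degree (r k)")
    case True
    have "nat \<bar>coeff (r k) i\<bar> \<le> (\<Sum>i\<le>degree (r k). nat \<bar>coeff (r k) i\<bar>)"
      using True by (intro member_le_sum) auto
    also have "\<dots> \<le> M" unfolding M_def using that 
      by (intro member_le_sum[where f = "\<lambda>k. \<Sum>i\<le>degree (r k). nat \<bar>coeff (r k) i\<bar>"]) auto
    finally show ?thesis .
  qed (simp add: coeff_eq_0)
  show thesis
  proof (rule that)
    fix p and w :: complex assume p: "prime p" "p > M" and w: "poly (of_int_poly f) w = 0"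
    obtain h where h: "pcompose f (monom 1 p) - f ^ p = of_nat p * h"
      using pcompose_monom_cong_power[OF p(1), of f] by auto
    obtain h' where h': "poly (of_int_poly h') z = poly (of_int_poly h) z"
      "h' = 0 \<or> degree h' < degree f" using int_minpoly_remainder[OF f] .
    define k where "k = p mod n"
    have k: "k < n" using n by (simp add: k_def)
    have "z ^ p = z ^ (n * (p div n) + k)" by (simp add: k_def)
    then have zk: "z ^ p = z ^ k" using z by (simp add: power_add power_mult)
    have p0: "p > 0" using p(1) prime_gt_0_nat by blast
    have "poly (of_int_poly (pcompose f (monom 1 p) - f ^ p)) z = poly (of_int_poly f) (z ^ p)"
      using f p0 unfolding int_minpoly_def
      by (simp add: hom_distribs poly_pcompose poly_monom)
    then have fp: "poly (of_int_poly f) (z ^ p) = of_nat p * poly (of_int_poly h) z"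
      unfolding h by (simp add: hom_distribs)
    \<comment> \<open>Both polynomials are reduced and take the same value at \<open>z\<close>, so
      they coincide. Hence every coefficient of \<open>r k\<close> is a multiple of
      \<open>p\<close>.\<close>
    have "r k - smult (int p) h' = 0"
    proof (rule int_minpoly_eq_0[OF f])
      show "poly (of_int_poly (r k - smult (int p) h')) z = 0"
        using r(1)[of k] h'(1) fp zk by (simp add: hom_distribs)
      show "r k - smult (int p) h' = 0 \<or> degree (r k - smult (int p) h') < degree f"
        using r(2)[of k] h'(2) by (cases "r k = 0"; cases "h' = 0") (auto intro: degree_diff_less)
    qed
    then have rk: "r k = smult (int p) h'" by simp
    have "coeff (r k) i = 0" for i
    proof (rule ccontr)
      assume "coeff (r k) i \<noteq> 0"
      moreover have "int p dvd coeff (r k) i" by (simp add: rk)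
      ultimately have "int p \<le> \<bar>coeff (r k) i\<bar>" using zdvd_imp_le[of "int p" "\<bar>coeff (r k) i\<bar>"] by simp
      with M[OF k, of i] p(2) show False by linarith
    qed
    then have "r k = 0" by (simp add: poly_eq_iff)
    then have "poly (of_int_poly (pcompose f (monom 1 p))) z = 0"
      using r(1)[of k] zk by (simp add: poly_pcompose_monom)
    then have "f dvd pcompose f (monom 1 p)" by (rule int_minpoly_dvd[OF f])
    then obtain q where "pcompose f (monom 1 p) = f * q" by auto
    then have "poly (of_int_poly (pcompose f (monom 1 p))) w = 0"
      using w by (simp add: hom_distribs)
    then show "poly (of_int_poly f) (w ^ p) = 0" by (simp add: poly_pcompose_monom)
  qed
qed

text \<open>Add to \<open>r\<close> the number \<open>n\<close> times the product of all primes up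
  to \<open>M\<close> not dividing \<open>r\<close>. A prime up to \<open>M\<close> divides exactly
  one of the two summands, hence not their sum.\<close>

lemma exists_cong_large_prime_factors:
  fixes r n M :: nat
  assumes "coprime r n" "n > 0"
  obtains m where "[m = r] (mod n)" "m > 0" "\<And>p. prime p \<Longrightarrow> p dvd m \<Longrightarrow> p > M"
proof -
  define P where "P = {p. prime p \<and> p \<le> M \<and> \<not> p dvd r}"
  have fin: "finite P" by (rule finite_subset[of _ "{..M}"]) (auto simp: P_def)
  have pos: "\<Prod>P > 0" using fin by (auto simp: P_def prod_pos prime_gt_0_nat)
  show thesis
  proof (rule that[of "r + n * \<Prod>P"])
    show "[r + n * \<Prod>P = r] (mod n)" by (simp add: cong_def)
    show "r + n * \<Prod>P > 0" using pos assms by simp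
    fix p :: nat assume p: "prime p" "p dvd r + n * \<Prod>P"
    show "p > M"
    proof (rule ccontr)
      assume le: "\<not> p > M"
      show False
      proof (cases "p dvd r")
        case True
        then have "p dvd n * \<Prod>P" using p(2) by (simp add: dvd_add_right_iff)
        moreover have "\<not> p dvd n" using True assms p(1) coprime_common_divisor_nat[of r n p]
          by auto
        ultimately have "p dvd \<Prod>P" using p(1) by (simp add: prime_dvd_mult_iff)
        then obtain q where "q \<in> P" "p dvd q" using p(1) fin by (auto simp: prime_dvd_prod_iff)
        then show False using True p(1) primes_dvd_imp_eq[of p q] by (auto simp: P_def)
      next
        case False
        then have "p \<in> P" using p le by (simp add: P_def)
        then have "p dvd n * \<Prod>P" using dvd_prodI[OF fin, of p "\<lambda>x. x"] by simp
        then show False using p(2) False by (simp add: dvd_add_left_iff)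
      qed
    qed
  qed
qed

lemma int_minpoly_coprime_power:
  assumes f: "int_minpoly f z" and z: "z ^ n = 1" and n: "n > 0" and r: "coprime r n"
  shows "poly (of_int_poly f) (z ^ r) = 0"
proof -
  obtain M where M: "\<And>p (w::complex). prime p \<Longrightarrow> p > M \<Longrightarrow> poly (of_int_poly f) w = 0 \<Longrightarrow>
    poly (of_int_poly f) (w ^ p) = 0" using int_minpoly_large_prime[OF f z n] by metis
  obtain m where m: "[m = r] (mod n)" "m > 0" "\<And>p. prime p \<Longrightarrow> p dvd m \<Longrightarrow> p > M"
    using exists_cong_large_prime_factors[OF r n] by metis
  \<comment> \<open>The prime factors of \<open>m\<close> are peeled off one at a time; the root
    changes from \<open>w\<close> to \<open>w ^ p\<close>, so the induction must range over all
    roots.\<close>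
  have "poly (of_int_poly f) (w ^ m) = 0" if "poly (of_int_poly f) w = 0" for w :: complex
    using m(2,3) that
  proof (induction m arbitrary: w rule: less_induct)
    case (less m)
    show ?case
    proof (cases "m = 1")
      case True
      then show ?thesis using less.prems by simp
    next
      case False
      then obtain p where p: "prime p" "p dvd m" using prime_factor_nat by blast
      then obtain m' where m': "m = p * m'" by auto
      have m0: "m' > 0" using less.prems(1) m' by (cases m') auto
      then have "m' < m" using prime_gt_1_nat[OF p(1)] by (simp add: m')
      moreover have "poly (of_int_poly f) (w ^ p) = 0"
        using M[OF p(1) less.prems(2)[OF p] less.prems(3)] .
      moreover have "q > M" if "prime q" "q dvd m'" for q
        using less.prems(2)[OF that(1)] that(2) by (simp add: m')
      ultimately have "poly (of_int_poly f) ((w ^ p) ^ m') = 0"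
        using less.IH[of m' "w ^ p"] m0 by blast
      then show ?thesis by (simp add: m' power_mult)
    qed
  qed
  moreover have "poly (of_int_poly f) z = 0" using f by (simp add: int_minpoly_def)
  ultimately have "poly (of_int_poly f) (z ^ m) = 0" by blast
  moreover have "z ^ m = z ^ r"
  proof -
    have "z ^ k = z ^ (k mod n)" for k
    proof -
      have "z ^ k = z ^ (n * (k div n) + k mod n)" by simp
      also have "\<dots> = z ^ (k mod n)" using z by (simp only: power_add power_mult) simp
      finally show ?thesis .
    qed
    then show ?thesis using m(1) by (metis cong_def)
  qed
  ultimately show ?thesis by simp
qed

section \<open>Roots of unity and the degree of the minimal polynomial of
  \<open>xi n\<close>\<close>

lemma xi_power: "xi n ^ k = cis (2 * pi * real k / real n)"
  by (simp add: xi_def DeMoivre mult_ac)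

lemma xi_power_n: "n > 0 \<Longrightarrow> xi n ^ n = 1"
  by (simp add: xi_power)

lemma inj_on_xi_power: "n > 0 \<Longrightarrow> inj_on (\<lambda>k. xi n ^ k) {..<n}"
  using bij_betw_roots_unity[of n] unfolding xi_power bij_betw_def by blast

text \<open>The roots of \<open>f\<close> are counted in two ways: they are simple, and they are
  exactly the primitive \<open>n\<close>-th roots of unity.\<close>

lemma degree_int_minpoly_xi:
  assumes f: "int_minpoly f (xi n)" and n: "n > 1"
  shows "degree f = totient n"
proof -
  let ?f = "of_int_poly f :: complex poly"
  let ?R = "{z. poly ?f z = 0}"
  define h :: "int poly" where "h = monom 1 n - 1"
  have hz: "poly (of_int_poly h) z = z ^ n - 1" for z :: complex
    by (simp add: h_def hom_distribs poly_monom)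
  have dh: "degree h = n" 
    using degree_add_eq_left[of "- 1" "monom (1::int) n"] n by (simp add: h_def degree_monom_eq)
  have f0: "f \<noteq> 0" using f by (auto simp: int_minpoly_def)
  have finR: "finite ?R" using f0 by (intro poly_roots_finite) simp
  have "f dvd h" by (rule int_minpoly_dvd[OF f]) (use n in \<open>simp add: hz xi_power_n\<close>)
  then obtain q where q: "h = f * q" by auto
  have h0: "h \<noteq> 0" using dh n by auto
  then have q0: "q \<noteq> 0" using q by auto
  have dfq: "degree f + degree q = n" using dh q f0 q0 by (simp add: degree_mult_eq)
  have roots: "{z::complex. z ^ n = 1} = ?R \<union> {z. poly (of_int_poly q) z = 0}"
  proof -
    have "z ^ n = 1 \<longleftrightarrow> poly ?f z = 0 \<or> poly (of_int_poly q) z = 0" for z :: complex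
    proof -
      have "z ^ n - 1 = poly ?f z * poly (of_int_poly q) z"
        using hz[of z] by (simp add: q hom_distribs)
      then show ?thesis by (metis eq_iff_diff_eq_0 mult_eq_0_iff)
    qed
    then show ?thesis by auto
  qed
  \<comment> \<open>As \<open>X\<^sup>n - 1\<close> has \<open>n\<close> distinct roots, its divisor \<open>f\<close> has as many distinct roots as its degree.\<close>
  have "n = card {z::complex. z ^ n = 1}" using card_roots_unity_eq[of n] n by simp
  also have "\<dots> \<le> card ?R + card {z::complex. poly (of_int_poly q) z = 0}"
    unfolding roots by (rule card_Un_le)
  also have "card {z::complex. poly (of_int_poly q) z = 0} \<le> degree q"
    using poly_roots_degree[of "of_int_poly q :: complex poly"] q0 by simp
  finally have ge: "degree f \<le> card ?R" using dfq by linarith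
  have le: "card ?R \<le> degree f" using poly_roots_degree[of ?f] f0 by simp
  have n0: "n > 0" using n by simp
  have "?R = (\<lambda>k. xi n ^ k) ` totatives n"
  proof (intro equalityI subsetI)
    fix w assume "w \<in> (\<lambda>k. xi n ^ k) ` totatives n"
    then show "w \<in> ?R" using int_minpoly_coprime_power[OF f xi_power_n[OF n0] n0] by (auto simp: totatives_def)
  next
    fix w assume w: "w \<in> ?R"
    then have "w ^ n = 1" using roots by auto
    then have "w \<in> (\<lambda>k. xi n ^ k) ` {..<n}" 
      using bij_betw_roots_unity[OF n0] unfolding xi_power bij_betw_def by auto
    then obtain k where k: "k < n" "w = xi n ^ k" by auto
    \<comment> \<open>If \<open>k\<close> shared a factor with \<open>n\<close>, then
      \<open>w ^ e = 1\<close> with \<open>e < n\<close>. As \<open>f\<close> is also the minimal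
      polynomial of \<open>w\<close>, it would divide \<open>X^e - 1\<close>, giving the
      contradiction \<open>xi n ^ e = 1\<close>.\<close>
    define d where "d = gcd k n"
    define e where "e = n div d"
    have e: "n = d * e" by (simp add: d_def e_def)
    then have e0: "e > 0" using n0 by (cases e) auto
    have "n dvd k * e" 
    proof -
      have "k = d * (k div d)" by (simp add: d_def)
      then have "k * e = (d * e) * (k div d)" by (metis mult.assoc mult.commute)
      then show ?thesis unfolding e[symmetric] by (rule dvdI)
    qed
    then have "w ^ e = 1" using xi_power_n[OF n0] unfolding k(2) power_mult[symmetric] by (elim dvdE) (simp add: power_mult)
    then have "poly (of_int_poly (monom 1 e - 1)) w = 0" by (simp add: hom_distribs poly_monom)
    moreover have "int_minpoly f w" using int_minpoly_conjugate[OF f] w by simp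
    ultimately have "f dvd monom 1 e - 1" by (intro int_minpoly_dvd)
    then obtain s where s: "monom 1 e - 1 = f * s" by auto
    have "poly (of_int_poly (monom 1 e - 1)) (xi n) = 0"
      using f unfolding s by (simp add: hom_distribs int_minpoly_def)
    then have "xi n ^ e = xi n ^ 0" by (simp add: hom_distribs poly_monom)
    then have "\<not> e < n" using inj_onD[OF inj_on_xi_power[OF n0], of e 0] e0 n0 by auto
    then have "d = 1" using e n0 by (cases d) auto
    then have "coprime k n" unfolding d_def by (rule gcd_eq_1_imp_coprime)
    moreover from this have "k \<noteq> 0" using n by (cases "k = 0") auto
    ultimately have "k \<in> totatives n" using k n by (simp add: totatives_def)
    then show "w \<in> (\<lambda>k. xi n ^ k) ` totatives n" using k by auto
  qed
  moreover have "inj_on (\<lambda>k. xi n ^ k) (totatives n)"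
    using inj_on_xi_power[OF n0] by (rule inj_on_subset) (use totatives_less n in auto)
  ultimately have "card ?R = totient n" by (simp add: card_image totient_def)
  then show ?thesis using ge le by simp
qed

lemma int_minpoly_xi_exists:
  assumes "n > 1"
  obtains f where "int_minpoly f (xi n)" "degree f = totient n"
proof -
  have d: "degree (monom 1 n + (- 1) :: int poly) = n"
    using degree_add_eq_left[of "- 1" "monom (1::int) n"] assms by (simp add: degree_monom_eq)
  have "lead_coeff (monom 1 n + (- 1) :: int poly) = 1"
    unfolding d using assms by (simp add: coeff_1)
  moreover have "poly (of_int_poly (monom 1 n + (- 1))) (xi n) = 0"
    using assms by (simp add: hom_distribs poly_monom xi_power_n)
  ultimately obtain f where "int_minpoly f (xi n)" by (rule int_minpoly_exists)
  then show thesis using degree_int_minpoly_xi assms that by blast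
qed

section \<open>The ring of cyclotomic integers and its integral basis\<close>

lemma poly_of_int_poly_sum:
  assumes "degree r < d"
  shows "poly (of_int_poly r) (z::complex) = (\<Sum>j<d. of_int (coeff r j) * z ^ j)"
proof -
  have "poly (of_int_poly r) z = (\<Sum>j\<le>degree r. of_int (coeff r j) * z ^ j)"
    by (simp add: poly_altdef)
  also have "\<dots> = (\<Sum>j<d. of_int (coeff r j) * z ^ j)"
    using assms by (intro sum.mono_neutral_left) (auto simp: coeff_eq_0)
  finally show ?thesis .
qed

lemma emb_cong: "(\<And>j. j < totient n \<Longrightarrow> v $ j = w $ j) \<Longrightarrow> emb n v = emb n w"
  by (simp add: emb_def)

lemma emb_add: "v \<in> Lambda n \<Longrightarrow> w \<in> Lambda n \<Longrightarrow> emb n (v + w) = emb n v + emb n w"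
  by (simp add: emb_def Lambda_def algebra_simps sum.distrib)

lemma emb_diff: "v \<in> Lambda n \<Longrightarrow> w \<in> Lambda n \<Longrightarrow> emb n (v - w) = emb n v - emb n w"
  by (simp add: emb_def Lambda_def algebra_simps sum_subtractf)

lemma emb_eq_poly:
  "emb n v = poly (of_int_poly (\<Sum>j<totient n. monom (v $ j) j)) (xi n)"
  by (simp add: emb_def of_int_poly_hom.hom_sum poly_sum poly_monom)

text \<open>The coordinates of \<open>v - w\<close> are the coefficients of a polynomial vanishing
  at \<open>xi n\<close> whose degree is below that of the minimal polynomial.\<close>

lemma emb_inject:
  assumes n: "n > 1" and v: "v \<in> Lambda n" and w: "w \<in> Lambda n" and e: "emb n v = emb n w"
  shows "v = w"
proof -
  obtain f where f: "int_minpoly f (xi n)" "degree f = totient n"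
    using int_minpoly_xi_exists[OF n] .
  define d where "d = totient n"
  have d0: "d > 0" using n by (simp add: d_def)
  define u where "u = v - w"
  have u: "u \<in> Lambda n" "emb n u = 0" using v w e by (auto simp: u_def emb_diff Lambda_def)
  define r where "r = (\<Sum>j<d. monom (u $ j) j)"
  have c: "coeff r i = (if i < d then u $ i else 0)" for i
    by (simp add: r_def coeff_sum)
  have "degree r < d" using d0 by (intro degree_lessI) (auto simp: c)
  moreover have "poly (of_int_poly r) (xi n) = 0"
    using u(2) unfolding emb_eq_poly r_def d_def .
  ultimately have "r = 0" using int_minpoly_eq_0[OF f(1)] f(2) by (simp add: d_def)
  then have "u $ i = 0" if "i < d" for i using c[of i] that by simp
  then have "v $ i = w $ i" if "i < d" for i
    using that v w by (auto simp: u_def d_def Lambda_def)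
  then show ?thesis using v w by (intro eq_vecI) (auto simp: Lambda_def d_def)
qed

text \<open>Reduction modulo the minimal polynomial brings any polynomial in \<open>xi n\<close>
  below degree \<open>totient n\<close>. In this form the ring operations are inherited from integer
  polynomials.\<close>

lemma Mring_eq_range:
  assumes n: "n > 1"
  shows "Mring n = range (\<lambda>g. poly (of_int_poly g) (xi n))"
proof (intro equalityI subsetI)
  fix z assume "z \<in> Mring n"
  then show "z \<in> range (\<lambda>g. poly (of_int_poly g) (xi n))" by (auto simp: Mring_def emb_eq_poly)
next
  fix z assume "z \<in> range (\<lambda>g. poly (of_int_poly g) (xi n))"
  then obtain g where g: "z = poly (of_int_poly g) (xi n)" by auto
  obtain f where f: "int_minpoly f (xi n)" "degree f = totient n"
    using int_minpoly_xi_exists[OF n] .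
  obtain r where r: "poly (of_int_poly r) (xi n) = poly (of_int_poly g) (xi n)"
    "r = 0 \<or> degree r < degree f" using int_minpoly_remainder[OF f(1)] .
  have "degree r < totient n" using r(2) f(2) n by auto
  then have "z = emb n (vec (totient n) (coeff r))"
    using r(1) g by (simp add: poly_of_int_poly_sum emb_def)
  then show "z \<in> Mring n" by (auto simp: Mring_def Lambda_def)
qed

text \<open>\<open>emb\<close> reads only the entries below \<open>totient n\<close>, so a vector of
  any dimension has the same image as some vector in \<open>Lambda n\<close>.\<close>

lemma emb_in_Mring: "emb n v \<in> Mring n"
proof -
  have "emb n v = emb n (vec (totient n) (\<lambda>j. v $ j))" by (rule emb_cong) simp
  then show ?thesis by (auto simp: Mring_def Lambda_def)
qed

lemma Mring_add: "n > 1 \<Longrightarrow> y \<in> Mring n \<Longrightarrow> z \<in> Mring n \<Longrightarrow> y + z \<in> Mring n"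
  by (auto simp: Mring_eq_range simp flip: poly_add of_int_poly_hom.hom_add)

lemma Mring_uminus: "n > 1 \<Longrightarrow> z \<in> Mring n \<Longrightarrow> - z \<in> Mring n"
  by (auto simp: Mring_eq_range simp flip: poly_minus of_int_poly_hom.hom_uminus)

lemma Mring_mult: "n > 1 \<Longrightarrow> y \<in> Mring n \<Longrightarrow> z \<in> Mring n \<Longrightarrow> y * z \<in> Mring n"
  by (auto simp: Mring_eq_range simp flip: poly_mult of_int_poly_hom.hom_mult)

lemma xi_power_in_Mring: "n > 1 \<Longrightarrow> xi n ^ k \<in> Mring n"
  using poly_monom[of "1::complex" k "xi n"]
  by (auto simp: Mring_eq_range image_iff intro!: exI[of _ "monom 1 k"])

lemma Mring_power: "n > 1 \<Longrightarrow> z \<in> Mring n \<Longrightarrow> z ^ k \<in> Mring n"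
  using xi_power_in_Mring[of n 0] by (induction k) (auto intro: Mring_mult)

text \<open>For odd \<open>n\<close> the rotation by half the angle is minus the power of
  \<open>xi n\<close> with exponent \<open>(n + 1) / 2\<close>.\<close>

lemma rotation_in_Mring:
  assumes n: "n > 1"
  shows "cis (2 * pi / real (bigN n)) \<in> Mring n"
proof (cases "even n")
  case True
  then show ?thesis using xi_power_in_Mring[OF n, of 1] by (simp add: bigN_def xi_def)
next
  case False
  then obtain m where m: "n = 2 * m + 1" using oddE by blast
  have "2 * pi * real (m + 1) / real n = pi + pi / real n"
    using m by (simp add: field_simps)
  then have "xi n ^ (m + 1) = - cis (pi / real n)"
    by (simp only: xi_power cis_mult[symmetric]) simp
  then have "cis (2 * pi / real (bigN n)) = - (xi n ^ (m + 1))"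
    using False by (simp add: bigN_def)
  then show ?thesis using Mring_uminus[OF n xi_power_in_Mring[OF n]] by metis
qed

lemma rotation_power_bigN: "n > 1 \<Longrightarrow> cis (2 * pi / real (bigN n)) ^ bigN n = 1"
  by (auto simp: DeMoivre bigN_def)

lemma coords_Mring:
  assumes n: "n > 1" and z: "z \<in> Mring n"
  shows "coords n z \<in> Lambda n" "emb n (coords n z) = z"
proof -
  obtain v where v: "v \<in> Lambda n" "emb n v = z" using z by (auto simp: Mring_def)
  then have "coords n z = v"
    unfolding coords_def using emb_inject[OF n] by (intro the_equality) auto
  with v show "coords n z \<in> Lambda n" "emb n (coords n z) = z" by auto
qed

text \<open>
  The two disjuncts in the second claim matter because \<open>int vec\<close> also contains vectors of the wrong
  dimension: one application of \<^const>\<open>phi1\<close> moves any of them into \<^const>\<open>Lambda\<close>.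
\<close>

lemma phi1_power:
  assumes n: "n > 1"
  shows "emb n ((phi1 n ^^ k) v) = cis (2 * pi / real (bigN n)) ^ k * emb n v"
    and "k > 0 \<or> v \<in> Lambda n \<Longrightarrow> (phi1 n ^^ k) v \<in> Lambda n"
proof -
  have m: "cis (2 * pi / real (bigN n)) * emb n w \<in> Mring n" for w
    using Mring_mult[OF n rotation_in_Mring[OF n] emb_in_Mring] .
  have phi: "phi1 n w \<in> Lambda n" "emb n (phi1 n w) = cis (2 * pi / real (bigN n)) * emb n w" for w
    unfolding phi1_def using coords_Mring[OF n m] by auto
  show "emb n ((phi1 n ^^ k) v) = cis (2 * pi / real (bigN n)) ^ k * emb n v"
    by (induction k) (simp_all add: phi)
  show "(phi1 n ^^ k) v \<in> Lambda n" if "k > 0 \<or> v \<in> Lambda n"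
    using that by (cases k) (simp_all add: phi)
qed

section \<open>Bravais colorings\<close>

lemma principal_ideal_mult:
  assumes "n > 1" "m \<in> Mring n" "z \<in> principal_ideal n a"
  shows "m * z \<in> principal_ideal n a"
proof -
  obtain b where b: "b \<in> Mring n" "z = a * b" using assms by (auto simp: principal_ideal_def)
  then have "m * z = a * (m * b)" by simp
  then show ?thesis using Mring_mult[OF assms(1,2) b(1)] unfolding principal_ideal_def by blast
qed

lemma principal_ideal_add:
  assumes "n > 1" "y \<in> principal_ideal n a" "z \<in> principal_ideal n a"
  shows "y + z \<in> principal_ideal n a"
proof -
  obtain b c where b: "b \<in> Mring n" "y = a * b" "c \<in> Mring n" "z = a * c"
    using assms by (auto simp: principal_ideal_def)
  then have "y + z = a * (b + c)" by (simp add: algebra_simps)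
  then show ?thesis using Mring_add[OF assms(1) b(1,3)] unfolding principal_ideal_def by blast
qed

lemma principal_ideal_diff:
  assumes n: "n > 1" and "y \<in> principal_ideal n a" "z \<in> principal_ideal n a"
  shows "y - z \<in> principal_ideal n a"
  using principal_ideal_add[OF n assms(2) principal_ideal_mult[OF n _ assms(3), of "- 1"]]
    Mring_uminus[OF n xi_power_in_Mring[OF n, of 0]] by simp

text \<open>Transfers questions about \<open>L\<close> to complex numbers. The ideal lies in
  \<open>Mring n\<close> because \<open>a\<close> does, and there \<open>coords\<close> really
  inverts \<open>emb\<close>.\<close>

lemma coords_principal_ideal_iff:
  assumes n: "n > 1" and a: "a \<in> Mring n"
  shows "v \<in> coords n ` principal_ideal n a \<longleftrightarrow> v \<in> Lambda n \<and> emb n v \<in> principal_ideal n a"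
proof
  assume "v \<in> coords n ` principal_ideal n a"
  then obtain z where z: "z \<in> principal_ideal n a" "v = coords n z" by auto
  have "z \<in> Mring n" using z(1) Mring_mult[OF n a] by (auto simp: principal_ideal_def)
  then show "v \<in> Lambda n \<and> emb n v \<in> principal_ideal n a" using coords_Mring[OF n] z by simp
next
  assume v: "v \<in> Lambda n \<and> emb n v \<in> principal_ideal n a"
  have "coords n (emb n v) = v"
    using emb_inject[OF n] coords_Mring[OF n emb_in_Mring] v by blast
  then show "v \<in> coords n ` principal_ideal n a" using v by (metis imageI)
qed

section \<open>Cosets of the ideal lattice and the symmetries permuting them\<close>

lemma lcoset_iff:
  assumes n: "n > 1" and a: "a \<in> Mring n" and x: "x \<in> Lambda n"
  shows "w \<in> lcoset (coords n ` principal_ideal n a) x \<longleftrightarrow>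
    w \<in> Lambda n \<and> emb n w - emb n x \<in> principal_ideal n a"
proof
  assume "w \<in> lcoset (coords n ` principal_ideal n a) x"
  then obtain y where y: "y \<in> Lambda n" "emb n y \<in> principal_ideal n a" "w = x + y"
    using coords_principal_ideal_iff[OF n a] by (auto simp: lcoset_def)
  then show "w \<in> Lambda n \<and> emb n w - emb n x \<in> principal_ideal n a"
    using x by (simp add: emb_add) (simp add: Lambda_def)
next
  assume w: "w \<in> Lambda n \<and> emb n w - emb n x \<in> principal_ideal n a"
  then have "w - x \<in> coords n ` principal_ideal n a"
    unfolding coords_principal_ideal_iff[OF n a] using x by (simp add: emb_diff) (simp add: Lambda_def)
  moreover have "w = x + (w - x)" using w x by (auto simp: Lambda_def)
  ultimately show "w \<in> lcoset (coords n ` principal_ideal n a) x" unfolding lcoset_def by blast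
qed

lemma lcoset_eq:
  assumes n: "n > 1" and a: "a \<in> Mring n" and x: "x \<in> Lambda n"
    and w: "w \<in> lcoset (coords n ` principal_ideal n a) x"
  shows "lcoset (coords n ` principal_ideal n a) w = lcoset (coords n ` principal_ideal n a) x"
proof -
  have w': "w \<in> Lambda n" "emb n w - emb n x \<in> principal_ideal n a"
    using w lcoset_iff[OF n a x] by auto
  have "emb n u - emb n w \<in> principal_ideal n a \<longleftrightarrow> emb n u - emb n x \<in> principal_ideal n a" for u
    using principal_ideal_add[OF n _ w'(2), of "emb n u - emb n w"]
      principal_ideal_diff[OF n _ w'(2), of "emb n u - emb n x"] by auto
  then show ?thesis using lcoset_iff[OF n a x] lcoset_iff[OF n a w'(1)] by blast
qed

lemma mem_lcoset_self:
  assumes "n > 1" "a \<in> Mring n" "x \<in> Lambda n"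
  shows "x \<in> lcoset (coords n ` principal_ideal n a) x"
proof -
  have "0 \<in> Mring n" using assms(1) Mring_add[OF assms(1) xi_power_in_Mring Mring_uminus[OF _ xi_power_in_Mring], of 0 0]
    by simp
  then have "a * 0 \<in> principal_ideal n a" unfolding principal_ideal_def by blast
  then show ?thesis using assms by (simp add: lcoset_iff)
qed

lemma phi1_power_color_symmetry:
  assumes n: "n > 1" and a: "a \<in> Mring n" and k: "k > 0"
  shows "phi1 n ^^ k \<in> color_symmetry n (coords n ` principal_ideal n a)"
proof -
  define L where "L = coords n ` principal_ideal n a"
  define e where "e = cis (2 * pi / real (bigN n))"
  \<comment> \<open>The inverse of \<open>e ^ k\<close>, written with a nonnegative exponent so that
    it visibly lies in \<open>Mring n\<close>; it supplies the preimages.\<close>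
  define e' where "e' = e ^ ((bigN n - 1) * k)"
  have eM: "e ^ k \<in> Mring n" "e' \<in> Mring n"
    unfolding e'_def e_def using Mring_power[OF n rotation_in_Mring[OF n]] by auto
  have "bigN n > 0" using n by (auto simp: bigN_def)
  then have "(bigN n - 1) * k + k = bigN n * k" by (cases "bigN n") auto
  then have "e' * e ^ k = (e ^ bigN n) ^ k"
    unfolding e'_def by (simp flip: power_add power_mult)
  then have ee: "e' * e ^ k = 1" using rotation_power_bigN[OF n] by (simp add: e_def)
  note emb_phi = phi1_power(1)[OF n, folded e_def]
  \<comment> \<open>Adding the zero vector changes the dimension of vectors outside
    \<open>Lambda n\<close>. For \<open>k > 0\<close> the value is already in
    \<open>Lambda n\<close>, so the functions agree on the whole type.\<close>
  have "phi1 n ^^ k = (\<lambda>v. (phi1 n ^^ k) v + 0\<^sub>v (totient n))"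
    using phi1_power(2)[OF n] k by (auto simp: Lambda_def)
  moreover have "phi1 n ^^ k \<in> dihedral n"
    unfolding dihedral_def by (intro CollectI exI[of _ k] exI[of _ 0]) simp
  moreover have "0\<^sub>v (totient n) \<in> Lambda n" by (simp add: Lambda_def)
  ultimately have "phi1 n ^^ k \<in> symG n" unfolding symG_def by blast
  moreover have "(phi1 n ^^ k) ` lcoset L x = lcoset L ((phi1 n ^^ k) x)" if x: "x \<in> Lambda n" for x
  proof (intro equalityI subsetI)
    have x': "(phi1 n ^^ k) x \<in> Lambda n" using phi1_power(2)[OF n] x by blast
    note iff = lcoset_iff[OF n a x, folded L_def] lcoset_iff[OF n a x', folded L_def]
    {
      fix w assume "w \<in> (phi1 n ^^ k) ` lcoset L x"
      then obtain u where u: "w = (phi1 n ^^ k) u" "u \<in> Lambda n" 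
        "emb n u - emb n x \<in> principal_ideal n a" using iff(1) by auto
      have "e ^ k * (emb n u - emb n x) \<in> principal_ideal n a"
        using principal_ideal_mult[OF n eM(1) u(3)] .
      then show "w \<in> lcoset L ((phi1 n ^^ k) x)"
        unfolding iff u(1) emb_phi using phi1_power(2)[OF n] u(2) by (simp add: right_diff_distrib)
    }
    fix w assume "w \<in> lcoset L ((phi1 n ^^ k) x)"
    then have w: "w \<in> Lambda n" "emb n w - e ^ k * emb n x \<in> principal_ideal n a"
      by (simp_all add: iff emb_phi)
    define u where "u = coords n (e' * emb n w)"
    have u: "u \<in> Lambda n" "emb n u = e' * emb n w"
      using coords_Mring[OF n Mring_mult[OF n eM(2) emb_in_Mring]] by (auto simp: u_def)
    have "emb n ((phi1 n ^^ k) u) = (e' * e ^ k) * emb n w" by (simp add: emb_phi u)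
    then have "(phi1 n ^^ k) u = w"
      using emb_inject[OF n _ w(1)] phi1_power(2)[OF n] u(1) ee by simp
    moreover have "emb n u - emb n x = e' * (emb n w - e ^ k * emb n x)"
      using ee by (simp add: u right_diff_distrib flip: mult.assoc)
    then have "u \<in> lcoset L x"
      using iff(1) u(1) principal_ideal_mult[OF n eM(2) w(2)] by simp
    ultimately show "w \<in> (phi1 n ^^ k) ` lcoset L x" by blast
  qed
  moreover have "(phi1 n ^^ k) x \<in> Lambda n" if "x \<in> Lambda n" for x
    using phi1_power(2)[OF n] that by blast
  ultimately show ?thesis unfolding color_symmetry_def L_def by blast
qed

text \<open>One point decides for its whole coset: the image of the coset of \<open>x i\<close> is
  again a coset, and it contains \<open>g (x i)\<close>. If that point lies in the original coset,
  the two cosets meet and are equal.\<close>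

lemma color_fixing_iff:
  assumes n: "n > 1" and a: "a \<in> Mring n" and L: "L = coords n ` principal_ideal n a"
    and x: "\<And>i. i < l \<Longrightarrow> x i \<in> Lambda n"
    and cosets: "bij_betw (\<lambda>i. lcoset L (x i)) {..<l} (lcosets n L)"
    and g: "\<And>v. v \<in> Lambda n \<Longrightarrow> g v \<in> Lambda n" and sym: "g \<in> color_symmetry n L"
  shows "g \<in> color_fixing n L \<longleftrightarrow> (\<forall>i<l. g (x i) - x i \<in> L)"
proof -
  have diff: "g (x i) - x i \<in> L \<longleftrightarrow> g (x i) \<in> lcoset L (x i)" if "i < l" for i
    using x[OF that] g[OF x[OF that]]
    unfolding L coords_principal_ideal_iff[OF n a] lcoset_iff[OF n a x[OF that]]
    by (simp add: emb_diff) (simp add: Lambda_def)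
  have self: "v \<in> lcoset L v" if "v \<in> Lambda n" for v
    using mem_lcoset_self[OF n a that] by (simp add: L)
  note eq = lcoset_eq[OF n a, folded L]
  show ?thesis
  proof
    assume "g \<in> color_fixing n L"
    then have "g ` lcoset L (x i) = lcoset L (x i)" if "i < l" for i
      using x[OF that] by (auto simp: color_fixing_def)
    then show "\<forall>i<l. g (x i) - x i \<in> L" using diff self x by blast
  next
    assume R: "\<forall>i<l. g (x i) - x i \<in> L"
    have "g ` lcoset L v = lcoset L v" if v: "v \<in> Lambda n" for v
    proof -
      have "lcoset L v \<in> (\<lambda>i. lcoset L (x i)) ` {..<l}"
        using cosets v unfolding bij_betw_def lcosets_def by blast
      then obtain i where i: "i < l" "lcoset L v = lcoset L (x i)" by auto
      obtain v' where v': "v' \<in> Lambda n" "g ` lcoset L (x i) = lcoset L v'"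
        using sym x[OF i(1)] by (auto simp: color_symmetry_def)
      have "g (x i) \<in> lcoset L v'" using self[OF x[OF i(1)]] v'(2) by blast
      then have "lcoset L (g (x i)) = lcoset L v'" using eq v'(1) by blast
      moreover have "lcoset L (g (x i)) = lcoset L (x i)"
        using eq[OF x[OF i(1)]] diff[OF i(1)] R i(1) by blast
      ultimately show ?thesis using i(2) v'(2) by simp
    qed
    then show "g \<in> color_fixing n L" using sym by (simp add: color_fixing_def)
  qed
qed

text \<open>\<open>Sinv\<close> yields the unique real coordinates of \<open>v\<close> with respect
  to the columns of \<open>S\<close>; \<open>v\<close> lies in the lattice they span iff these are
  integers.\<close>

lemma integral_vec_inverse_iff:
  fixes S :: "int mat" and Sinv :: "real mat"
  assumes S: "S \<in> carrier_mat d d" and Sinv: "Sinv \<in> carrier_mat d d"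
    and inv: "inverts_mat (map_mat real_of_int S) Sinv" and v: "v \<in> carrier_vec d"
  shows "integral_vec (Sinv *\<^sub>v map_vec real_of_int v) \<longleftrightarrow> v \<in> {S *\<^sub>v c | c. c \<in> carrier_vec d}"
proof -
  let ?S = "map_mat real_of_int S" and ?v = "map_vec real_of_int v"
  have S': "?S \<in> carrier_mat d d" using S by simp
  have v': "?v \<in> carrier_vec d" using v by simp
  have r: "?S * Sinv = 1\<^sub>m d" using inv S by (simp add: inverts_mat_def)
  have l: "Sinv * ?S = 1\<^sub>m d" using mat_mult_left_right_inverse[OF S' Sinv r] .
  show ?thesis
  proof
    assume int: "integral_vec (Sinv *\<^sub>v ?v)"
    \<comment> \<open>The entries are integers already; \<open>floor\<close> only changes their
      type.\<close>
    define c where "c = map_vec floor (Sinv *\<^sub>v ?v)"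
    have c: "c \<in> carrier_vec d" using mult_mat_vec_carrier[OF Sinv v'] by (simp add: c_def)
    have "map_vec real_of_int c = Sinv *\<^sub>v ?v"
      using int by (intro eq_vecI) (auto simp: c_def integral_vec_def elim!: Ints_cases)
    then have "map_vec real_of_int (S *\<^sub>v c) = ?S *\<^sub>v (Sinv *\<^sub>v ?v)"
      by (simp add: of_int_hom.mult_mat_vec_hom[OF S c])
    also have "\<dots> = ?v" using assoc_mult_mat_vec[OF S' Sinv v'] r v' by simp
    finally have "S *\<^sub>v c = v" by (rule of_int_hom.vec_hom_inj)
    then show "v \<in> {S *\<^sub>v c | c. c \<in> carrier_vec d}" using c by blast
  next
    assume "v \<in> {S *\<^sub>v c | c. c \<in> carrier_vec d}"
    then obtain c where c: "c \<in> carrier_vec d" "v = S *\<^sub>v c" by blast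
    have c': "map_vec real_of_int c \<in> carrier_vec d" using c by simp
    have "Sinv *\<^sub>v ?v = Sinv *\<^sub>v (?S *\<^sub>v map_vec real_of_int c)"
      by (simp add: c(2) of_int_hom.mult_mat_vec_hom[OF S c(1)])
    also have "\<dots> = map_vec real_of_int c"
      using assoc_mult_mat_vec[OF Sinv S' c'] l c' by simp
    finally show "integral_vec (Sinv *\<^sub>v ?v)" by (simp add: integral_vec_def)
  qed
qed

lemma pow_mat_mult_vec_funpow:
  fixes A :: "'a :: semiring_1 mat"
  assumes A: "A \<in> carrier_mat d d" and f: "\<forall>v\<in>carrier_vec d. A *\<^sub>v v = f v" and v: "v \<in> carrier_vec d"
  shows "(A ^\<^sub>m k) *\<^sub>v v = (f ^^ k) v"
  using v
proof (induction k arbitrary: v)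
  case 0
  then show ?case using A by simp
next
  case (Suc k)
  have "(A ^\<^sub>m Suc k) *\<^sub>v v = (A ^\<^sub>m k) *\<^sub>v (A *\<^sub>v v)"
    using A Suc.prems by (simp add: assoc_mult_mat_vec[OF pow_carrier_mat[OF A] A])
  also have "\<dots> = (f ^^ k) (A *\<^sub>v v)" using A Suc.prems by (intro Suc.IH) simp
  also have "\<dots> = (f ^^ Suc k) v" using f Suc.prems by (simp add: funpow_swap1)
  finally show ?case .
qed

theorem theorem3p2p2:
  fixes n l :: nat and a :: complex and L :: "int vec set"
    and S A B :: "int mat" and Sinv :: "real mat" and x :: "nat \<Rightarrow> int vec"
  assumes n: "n \<in> pid_cyclotomic_indices"
    and a: "a \<in> Mring n"
    and L: "L = coords n ` principal_ideal n a"
    and x_in: "\<forall>i < l. x i \<in> Lambda n"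
    and x_cosets: "bij_betw (\<lambda>i. lcoset L (x i)) {..<l} (lcosets n L)"
    and S: "S \<in> carrier_mat (totient n) (totient n)"
    and S_gen: "L = {S *\<^sub>v c | c. c \<in> carrier_vec (totient n)}"
    and Sinv: "Sinv \<in> carrier_mat (totient n) (totient n)"
    and Sinv_inv: "inverts_mat (map_mat real_of_int S) Sinv"
    and A: "A \<in> carrier_mat (totient n) (totient n)"
    and A_rep: "\<forall>v \<in> Lambda n. A *\<^sub>v v = phi1 n v"
    and B: "B \<in> carrier_mat (totient n) (totient n)"
    and B_rep: "\<forall>v \<in> Lambda n. B *\<^sub>v v = phi2 n v"
  shows "(phi2 n \<in> color_fixing n L \<longleftrightarrow>
            phi2 n \<in> color_symmetry n L \<and>
            (\<forall>i < l. integral_vec (Sinv *\<^sub>v map_vec real_of_int (B *\<^sub>v x i - x i))))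
       \<and> (\<forall>k. k dvd bigN n \<longrightarrow>
            (phi1 n ^^ k \<in> color_fixing n L \<longleftrightarrow>
              (\<forall>i < l. integral_vec (Sinv *\<^sub>v map_vec real_of_int ((A ^\<^sub>m k) *\<^sub>v x i - x i)))))"
proof -
  have n1: "n > 1" using n by (auto simp: pid_cyclotomic_indices_def)
  have x: "x i \<in> Lambda n" if "i < l" for i using x_in that by blast
  note fixing_iff = color_fixing_iff[OF n1 a L x x_cosets]
  have int: "integral_vec (Sinv *\<^sub>v map_vec real_of_int (y - x i)) \<longleftrightarrow> y - x i \<in> L"
    if "i < l" for i y
  proof -
    have "y - x i \<in> carrier_vec (totient n)" using x[OF that] by (intro carrier_vecI) (simp add: Lambda_def)
    then show ?thesis by (rule integral_vec_inverse_iff[OF S Sinv Sinv_inv, folded S_gen])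
  qed
  \<comment> \<open>Invariance of \<open>Lambda n\<close> under conjugation is read off from the
    integer matrix \<open>B\<close>.\<close>
  have phi2: "phi2 n v \<in> Lambda n" if "v \<in> Lambda n" for v
    using B_rep that B by (metis Lambda_def mult_mat_vec_carrier)
  have "phi2 n \<in> color_fixing n L \<longleftrightarrow> phi2 n \<in> color_symmetry n L \<and>
      (\<forall>i < l. integral_vec (Sinv *\<^sub>v map_vec real_of_int (B *\<^sub>v x i - x i)))"
    using fixing_iff[of "phi2 n"] phi2 B_rep x int by (auto simp: color_fixing_def[of n L])
  moreover have "phi1 n ^^ k \<in> color_fixing n L \<longleftrightarrow>
      (\<forall>i < l. integral_vec (Sinv *\<^sub>v map_vec real_of_int ((A ^\<^sub>m k) *\<^sub>v x i - x i)))"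
    if k: "k dvd bigN n" for k
  proof -
    \<comment> \<open>\<open>bigN n\<close> is positive, so its divisor \<open>k\<close> is too, as
      the color symmetry lemma for powers of \<open>phi1\<close> requires.\<close>
    have "k > 0" using k n1 by (intro Nat.gr0I) (auto simp: bigN_def split: if_splits)
    then have "phi1 n ^^ k \<in> color_symmetry n L"
      using phi1_power_color_symmetry[OF n1 a] by (simp add: L)
    moreover have "(A ^\<^sub>m k) *\<^sub>v x i = (phi1 n ^^ k) (x i)" if "i < l" for i
      using pow_mat_mult_vec_funpow[OF A A_rep[unfolded Lambda_def]] x[OF that]
      by (simp add: Lambda_def)
    ultimately show ?thesis using fixing_iff[of "phi1 n ^^ k"] phi1_power(2)[OF n1] int by simp
  qed
  ultimately show ?thesis by blast
qed

end
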